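(* The function $f:\mathbb{R}^d\to\mathbb{R}$, $f(x)=\sigma\left(\sum_{i=1}^d i\cdot x_i\right)$, satisfies $f\in\mathcal{F}^{d}_{pruned}$ and $f\notin\mathcal{F}^{d}_{bin}$; that is, without pruning, $f$ cannot be represented by a single layer binary network of width $d$.
   Context: $\sigma(z)=\max\{z,0\}$ is the ReLU. For input dimension $d$ and width $m$, define the classes of functions $\mathbb{R}^d\to\mathbb{R}$ $$\mathcal{F}^{m}_{pruned}=\left\{f:\ f(x)=\sigma\left(\sum_{i=1}^d x_i\,\sigma\left(\sum_{j=1}^m v_jw_j^{i}\right)\right),\ w_j^{i},v_j\in\{+1,-1,0\}\right\},$$ $$\mathcal{F}^{m}_{bin}=\left\{f:\ f(x)=\sigma\left(\sum_{i=1}^d x_i\,\sigma\left(\sum_{j=1}^m v_jw_j^{i}\right)\right),\ w_j^{i},v_j\in\{+1,-1\}\right\},$$ where $i$ ranges over $\{1,\dots,d\}$ and $j$ over $\{1,\dots,m\}$, and $w_j^i$ denotes a weight indexed by $i$ and $j$ (not a power). $\mathcal{F}^m_{pruned}$ is described as the set of all networks that can be derived by pruning 1-hidden-layer binary networks of width $m$ and input dimension $d$, and $\mathcal{F}^m_{bin}$ as the set of all 1-hidden-layer binary networks of the same width without pruning. "Single layer binary network of width $d$" refers to the class $\mathcal{F}^d_{bin}$.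
   Formalization: The non-membership of f in F_bin^d is stated only for d ≥ 2, since for d = 1 the function σ(x_1) is the binary network with v_1 = w_1^1 = 1; membership in F_pruned^d is stated for all d. *)

theory Defs
  imports Complex_Main "HOL-Library.FuncSet"
begin

definition relu :: "real \<Rightarrow> real" where
  "relu z = max z 0"

text \<open>Points of \<open>\<real>\<^sup>d\<close> are the functions \<open>{1..d} \<rightarrow> \<real>\<close>, extended by \<open>undefined\<close> outside
  \<open>{1..d}\<close>. Maps \<open>\<real>\<^sup>d \<rightarrow> \<real>\<close> are in turn extensional on \<open>Rn d\<close>, so that equality in HOL
  is equality of maps on \<open>\<real>\<^sup>d\<close>.\<close>

definition Rn :: "nat \<Rightarrow> (nat \<Rightarrow> real) set" where
  "Rn d = {1..d} \<rightarrow>\<^sub>E UNIV"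

text \<open>The weight \<open>w\<^sub>j\<^sup>i\<close> (the superscript is an index) is \<open>w j i\<close>.\<close>

definition network ::
  "nat \<Rightarrow> nat \<Rightarrow> (nat \<Rightarrow> real) \<Rightarrow> (nat \<Rightarrow> nat \<Rightarrow> real) \<Rightarrow> (nat \<Rightarrow> real) \<Rightarrow> real" where
  "network d m v w =
     (\<lambda>x\<in>Rn d. relu (\<Sum>i=1..d. x i * relu (\<Sum>j=1..m. v j * w j i)))"

definition F_pruned :: "nat \<Rightarrow> nat \<Rightarrow> ((nat \<Rightarrow> real) \<Rightarrow> real) set" where
  "F_pruned d m = {network d m v w | v w.
     \<forall>j\<in>{1..m}. v j \<in> {1, -1, 0} \<and> (\<forall>i\<in>{1..d}. w j i \<in> {1, -1, 0})}"

definition F_bin :: "nat \<Rightarrow> nat \<Rightarrow> ((nat \<Rightarrow> real) \<Rightarrow> real) set" where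
  "F_bin d m = {network d m v w | v w.
     \<forall>j\<in>{1..m}. v j \<in> {1, -1} \<and> (\<forall>i\<in>{1..d}. w j i \<in> {1, -1})}"

end

theory Submission
  imports Defs
begin

text \<open>
  Pruned: take \<open>v = 1\<close> and let \<open>w\<^sub>j\<^sup>i\<close> be the indicator of \<open>j \<le> i\<close>, so that hidden neuron \<open>i\<close>
  has weight \<open>i\<close>. Binary: evaluating at the \<open>i\<close>-th standard basis vector forces the inner sum
  \<open>\<Sum>\<^sub>j v\<^sub>j w\<^sub>j\<^sup>i\<close> to equal \<open>i\<close>. As a sum of \<open>d\<close> signs it has the parity of \<open>d\<close>, which cannot hold
  for both \<open>i = 1\<close> and \<open>i = 2\<close>.
\<close>

text \<open>Both signs are odd, so each new term flips the parity of the sum along with that of the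
  cardinality.\<close>

lemma sum_signs_parity:
  fixes a :: "'a \<Rightarrow> real"
  assumes "finite A" "\<And>j. j \<in> A \<Longrightarrow> a j \<in> {1, -1}"
  shows "\<exists>k::int. sum a A = of_int k \<and> (even k \<longleftrightarrow> even (card A))"
  using assms
proof (induction A rule: finite_induct)
  case empty
  show ?case by (intro exI[of _ 0]) simp
next
  case (insert x A)
  then obtain k :: int where k: "sum a A = of_int k" "even k \<longleftrightarrow> even (card A)"
    by auto
  from insert.prems[of x] consider "a x = 1" | "a x = -1" by auto
  then show ?case
  proof cases
    case 1
    with k insert.hyps show ?thesis by (intro exI[of _ "k + 1"]) simp
  next
    case 2
    with k insert.hyps show ?thesis by (intro exI[of _ "k - 1"]) simp
  qed
qed

definition unit_vec :: "nat \<Rightarrow> nat \<Rightarrow> nat \<Rightarrow> real" where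
  "unit_vec d k = (\<lambda>i\<in>{1..d}. if i = k then 1 else 0)"

lemma unit_vec_in_Rn: "unit_vec d k \<in> Rn d"
  by (auto simp: unit_vec_def Rn_def)

lemma sum_unit_vec:
  assumes "k \<in> {1..d}"
  shows "(\<Sum>i=1..d. unit_vec d k i * c i) = c k"
proof -
  have "(\<Sum>i=1..d. unit_vec d k i * c i) = (\<Sum>i=1..d. if k = i then c i else 0)"
    by (rule sum.cong) (auto simp: unit_vec_def)
  also have "\<dots> = c k"
    using assms by (simp add: sum.delta')
  finally show ?thesis .
qed

text \<open>A basis vector isolates one hidden neuron; the outer \<open>relu\<close> disappears
  because \<open>relu\<close> is idempotent.\<close>

lemma network_unit_vec:
  assumes "k \<in> {1..d}"
  shows "network d m v w (unit_vec d k) = relu (\<Sum>j=1..m. v j * w j k)"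
  using sum_unit_vec[OF assms, of "\<lambda>i. relu (\<Sum>j=1..m. v j * w j i)"]
  by (simp add: network_def unit_vec_in_Rn relu_def)

text \<open>The bound \<open>d \<ge> 2\<close> is sharp: for \<open>d = 1\<close> the weights
  \<open>v = w = 1\<close> realise \<open>f\<close>, and for \<open>d = 0\<close> every function
  involved is zero on \<open>Rn d\<close>.\<close>

theorem proposition1:
  fixes d :: nat and f :: "(nat \<Rightarrow> real) \<Rightarrow> real"
  assumes f_def: "f = (\<lambda>x\<in>Rn d. relu (\<Sum>i=1..d. real i * x i))"
  shows "f \<in> F_pruned d d \<and> (d \<ge> 2 \<longrightarrow> f \<notin> F_bin d d)"
proof (intro conjI impI notI)
  define w :: "nat \<Rightarrow> nat \<Rightarrow> real" where "w j i = (if j \<le> i then 1 else 0)" for j i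
  have weight: "relu (\<Sum>j=1..d. 1 * w j i) = real i" if "i \<in> {1..d}" for i
  proof -
    \<comment> \<open>Terms with \<open>j > i\<close> vanish, and \<open>i \<le> d\<close> keeps
      \<open>{1..i}\<close> inside \<open>{1..d}\<close>.\<close>
    have "(\<Sum>j=1..d. 1 * w j i) = (\<Sum>j=1..i. 1)"
      using that by (intro sum.mono_neutral_cong_right) (auto simp: w_def)
    then show ?thesis by (simp add: relu_def)
  qed
  have "f = network d d (\<lambda>_. 1) w"
    unfolding f_def network_def
    by (intro restrict_ext arg_cong[where f = relu] sum.cong) (simp_all only: weight mult.commute)
  then show "f \<in> F_pruned d d"
    unfolding F_pruned_def by (auto simp: w_def split: if_splits intro!: exI[of _ "\<lambda>_. 1"] exI[of _ w])
next
  assume "2 \<le> d" "f \<in> F_bin d d"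
  then obtain v w where f: "f = network d d v w"
    and vw: "\<forall>j\<in>{1..d}. v j \<in> {1, -1} \<and> (\<forall>i\<in>{1..d}. w j i \<in> {1, -1})"
    unfolding F_bin_def by blast
  have parity: "even k \<longleftrightarrow> even d" if k: "k \<in> {1..d}" for k
  proof -
    have "f (unit_vec d k) = real k"
      using sum_unit_vec[OF k, of real]
      by (simp add: f_def unit_vec_in_Rn relu_def mult.commute)
    then have "relu (\<Sum>j=1..d. v j * w j k) = real k"
      using network_unit_vec[OF k] f by simp
    \<comment> \<open>Since \<open>k \<ge> 1\<close>, the value of \<open>relu\<close> is positive
      and so determines its argument.\<close>
    then have s: "(\<Sum>j=1..d. v j * w j k) = real k"
      using k by (auto simp: relu_def max_def split: if_splits)
    have "v j * w j k \<in> {1, -1}" if "j \<in> {1..d}" for j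
      using vw that k by fastforce
    then obtain l :: int where l: "(\<Sum>j=1..d. v j * w j k) = of_int l" "even l \<longleftrightarrow> even d"
      using sum_signs_parity[of "{1..d}" "\<lambda>j. v j * w j k"] by auto
    with s have "l = int k" by linarith
    with l show ?thesis by simp
  qed
  show False
    using parity[of 1] parity[of 2] \<open>2 \<le> d\<close> by simp
qed

end
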